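(* Let $\{A(k)\}_{k\ge0}$ and $\{B(k)\}_{k\ge0}$ be deterministic chains of $m\times m$ stochastic matrices such that $\{B(k)\}$ is an $\ell_1$-approximation of $\{A(k)\}$. Then the two chains have the same ergodicity classes.
   Context: $[m]=\{1,\dots,m\}$. A stochastic matrix is a nonnegative matrix whose rows each sum to $1$. $\{B(k)\}$ is an $\ell_1$-approximation of $\{A(k)\}$ if $\sum_{k=0}^\infty|A_{ij}(k)-B_{ij}(k)|<\infty$ for all $i,j\in[m]$. For a chain $\{A(k)\}$ consider the dynamics $x(k+1)=A(k)x(k)$, $k\ge t_0$. Indices $i,j\in[m]$ are mutually weakly ergodic, written $i\leftrightarrow_A j$, if $\lim_{k\to\infty}(x_i(k)-x_j(k))=0$ for every $t_0\ge 0$ and every $x(t_0)\in\mathbb{R}^m$. An index $i\in[m]$ is an ergodic index for the chain if $\lim_{k\to\infty}x_i(k)$ exists for every $t_0\ge0$ and every $x(t_0)\in\mathbb{R}^m$. Two chains $\{A(k)\}$ and $\{B(k)\}$ have the same ergodicity classes if there is a bijection $\theta:[m]\to[m]$ such that (a) $i\leftrightarrow_A j$ if and only if $\theta(i)\leftrightarrow_B\theta(j)$, and (b) $i$ is an ergodic index for $\{A(k)\}$ if and only if $\theta(i)$ is an ergodic index for $\{B(k)\}$. By convention $\theta$ is always taken to be the identity, so the assertion is: for all $i,j\in[m]$, $i\leftrightarrow_A j$ if and only if $i\leftrightarrow_B j$; and for all $i\in[m]$, $i$ is an ergodic index for $\{A(k)\}$ if and only if it is an ergodic index for $\{B(k)\}$.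 *)

theory Defs
  imports "HOL-Analysis.Analysis"
begin

definition stochastic_matrix :: "real^'m^'m \<Rightarrow> bool" where
  "stochastic_matrix M \<longleftrightarrow> (\<forall>i j. 0 \<le> M $ i $ j) \<and> (\<forall>i. (\<Sum>j\<in>UNIV. M $ i $ j) = 1)"

definition stochastic_chain :: "(nat \<Rightarrow> real^'m^'m) \<Rightarrow> bool" where
  "stochastic_chain A \<longleftrightarrow> (\<forall>k. stochastic_matrix (A k))"

definition l1_approximation ::
    "(nat \<Rightarrow> real^'m^'m) \<Rightarrow> (nat \<Rightarrow> real^'m^'m) \<Rightarrow> bool" where
  "l1_approximation B A \<longleftrightarrow> (\<forall>i j. summable (\<lambda>k. \<bar>A k $ i $ j - B k $ i $ j\<bar>))"

(* Only the values x k with k >= t0 are constrained. Every vector is the value at t0 of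
   some such x, and it determines all later values, so quantifying over t0 and over the
   solutions x from t0 is quantifying over starting times and starting vectors. *)
definition dynamics_from ::
    "(nat \<Rightarrow> real^'m^'m) \<Rightarrow> nat \<Rightarrow> (nat \<Rightarrow> real^'m) \<Rightarrow> bool" where
  "dynamics_from A t0 x \<longleftrightarrow> (\<forall>k\<ge>t0. x (Suc k) = A k *v x k)"

definition mutually_weakly_ergodic :: "(nat \<Rightarrow> real^'m^'m) \<Rightarrow> 'm \<Rightarrow> 'm \<Rightarrow> bool" where
  "mutually_weakly_ergodic A i j \<longleftrightarrow>
     (\<forall>t0 x. dynamics_from A t0 x \<longrightarrow> (\<lambda>k. x k $ i - x k $ j) \<longlonglongrightarrow> 0)"

definition ergodic_index :: "(nat \<Rightarrow> real^'m^'m) \<Rightarrow> 'm \<Rightarrow> bool" where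
  "ergodic_index A i \<longleftrightarrow> (\<forall>t0 x. dynamics_from A t0 x \<longrightarrow> convergent (\<lambda>k. x k $ i))"

definition same_ergodicity_classes_via ::
    "('m \<Rightarrow> 'm) \<Rightarrow> (nat \<Rightarrow> real^'m^'m) \<Rightarrow> (nat \<Rightarrow> real^'m^'m) \<Rightarrow> bool" where
  "same_ergodicity_classes_via \<theta> A B \<longleftrightarrow>
     bij \<theta> \<and>
     (\<forall>i j. mutually_weakly_ergodic A i j \<longleftrightarrow> mutually_weakly_ergodic B (\<theta> i) (\<theta> j)) \<and>
     (\<forall>i. ergodic_index A i \<longleftrightarrow> ergodic_index B (\<theta> i))"

(* The bijection between the indices is required to be the identity, which is stronger
   than asking for some bijection. *)
definition same_ergodicity_classes ::
    "(nat \<Rightarrow> real^'m^'m) \<Rightarrow> (nat \<Rightarrow> real^'m^'m) \<Rightarrow> bool" where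
  "same_ergodicity_classes A B \<longleftrightarrow> same_ergodicity_classes_via id A B"

end

theory Submission
  imports Defs
begin

text \<open>Restart the chain \<open>A\<close> at a late time \<open>s\<close> from the value there of a solution \<open>y\<close> of the chain
  \<open>B\<close>. Stochastic matrices do not expand the maximum norm, so the two solutions never drift apart by
  more than a bound on \<open>y\<close> times the tail from \<open>s\<close> on of the \<open>\<ell>\<^sub>1\<close>-distance of the chains. Hence the
  coordinates of \<open>y\<close> are uniform limits, up to finitely many times, of coordinates of \<open>A\<close>-solutions,
  and both defining limit properties survive such limits.\<close>

lemma stochastic_matrix_abs_mult_le:
  assumes "stochastic_matrix M" and "\<And>j. \<bar>v $ j\<bar> \<le> c"
  shows "\<bar>(M *v v) $ i\<bar> \<le> c"
proof -
  have nonneg: "0 \<le> M $ i $ j" for j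
    using assms(1) by (simp add: stochastic_matrix_def)
  have "\<bar>(M *v v) $ i\<bar> \<le> (\<Sum>j\<in>UNIV. \<bar>M $ i $ j * v $ j\<bar>)"
    by (simp add: matrix_vector_mult_def sum_abs)
  also have "\<dots> \<le> (\<Sum>j\<in>UNIV. M $ i $ j * c)"
    by (intro sum_mono) (simp add: abs_mult nonneg assms(2) mult_left_mono)
  also have "\<dots> = c"
    using assms(1) by (simp add: stochastic_matrix_def sum_distrib_right[symmetric])
  finally show ?thesis .
qed

text \<open>The crude constant, a sum over all entries, is convenient for
  \<open>M = A r - B r\<close>: its summability over \<open>r\<close> follows at once from the
  entrywise summability in \<open>l1_approximation\<close>.\<close>

lemma abs_matrix_vector_mult_le:
  fixes M :: "real^'n^'m"
  assumes "\<And>j. \<bar>v $ j\<bar> \<le> c"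
  shows "\<bar>(M *v v) $ i\<bar> \<le> (\<Sum>i\<in>UNIV. \<Sum>j\<in>UNIV. \<bar>M $ i $ j\<bar>) * c"
proof -
  have c: "0 \<le> c"
    using assms[of undefined] by linarith
  have "\<bar>(M *v v) $ i\<bar> \<le> (\<Sum>j\<in>UNIV. \<bar>M $ i $ j * v $ j\<bar>)"
    by (simp add: matrix_vector_mult_def sum_abs)
  also have "\<dots> \<le> (\<Sum>j\<in>UNIV. \<bar>M $ i $ j\<bar> * c)"
    by (intro sum_mono) (simp add: abs_mult assms mult_left_mono)
  also have "\<dots> = (\<Sum>j\<in>UNIV. \<bar>M $ i $ j\<bar>) * c"
    by (simp add: sum_distrib_right)
  also have "\<dots> \<le> (\<Sum>i\<in>UNIV. \<Sum>j\<in>UNIV. \<bar>M $ i $ j\<bar>) * c"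
    by (intro mult_right_mono c member_le_sum) (auto intro: sum_nonneg)
  finally show ?thesis .
qed

lemma dynamics_from_later:
  "dynamics_from A t x \<Longrightarrow> t \<le> s \<Longrightarrow> dynamics_from A s x"
  by (auto simp: dynamics_from_def)

lemma dynamics_from_exists: "\<exists>x. dynamics_from A t x \<and> x t = v"
proof -
  \<comment> \<open>Truncated subtraction makes \<open>x\<close> constantly \<open>v\<close> up to
    time \<open>t\<close>, where the dynamics impose nothing.\<close>
  define x where "x k = rec_nat v (\<lambda>n. (*v) (A (t + n))) (k - t)" for k
  have "dynamics_from A t x"
    by (auto simp: dynamics_from_def x_def Suc_diff_le)
  then show ?thesis
    by (auto simp: x_def)
qed

lemma dynamics_from_abs_le:
  assumes "stochastic_chain A" and "dynamics_from A t x" and "\<And>j. \<bar>x t $ j\<bar> \<le> c" and "t \<le> k"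
  shows "\<bar>x k $ i\<bar> \<le> c"
  using assms(4)
proof (induction k arbitrary: i rule: dec_induct)
  case base
  show ?case by (rule assms(3))
next
  case (step k)
  then show ?case
    using assms(1,2) stochastic_matrix_abs_mult_le[of "A k" "x k" c i]
    by (simp add: stochastic_chain_def dynamics_from_def)
qed

text \<open>A discrete Duhamel estimate: the error starts at 0, \<open>A r\<close> carries it on
  without amplification, and each step adds at most the distance of \<open>A r\<close> and
  \<open>B r\<close> times \<open>c\<close>.\<close>

lemma dynamics_from_diff_le:
  fixes A B :: "nat \<Rightarrow> real^'m^'m"
  assumes A: "stochastic_chain A"
    and x: "dynamics_from A s x" and y: "dynamics_from B s y" and start: "x s = y s"
    and bound: "\<And>k j. s \<le> k \<Longrightarrow> \<bar>y k $ j\<bar> \<le> c" and "s \<le> k"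
  shows "\<bar>y k $ i - x k $ i\<bar> \<le> (\<Sum>r=s..<k. \<Sum>i\<in>UNIV. \<Sum>j\<in>UNIV. \<bar>A r $ i $ j - B r $ i $ j\<bar>) * c"
  using \<open>s \<le> k\<close>
proof (induction k arbitrary: i rule: dec_induct)
  case base
  then show ?case by (simp add: start)
next
  case (step k)
  let ?d = "\<lambda>r. \<Sum>i\<in>UNIV. \<Sum>j\<in>UNIV. \<bar>A r $ i $ j - B r $ i $ j\<bar>"
  \<comment> \<open>The defect \<open>A k - B k\<close> is applied to \<open>y k\<close>, for which
    the bound \<open>c\<close> is available, so that the old error meets only the stochastic
    \<open>A k\<close>.\<close>
  have split: "y (Suc k) - x (Suc k) = A k *v (y k - x k) - (A k - B k) *v y k"
    using x y step.hyps
    by (simp add: dynamics_from_def matrix_vector_mult_diff_distrib matrix_vector_mult_diff_rdistrib)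
  have "\<bar>(A k *v (y k - x k)) $ i\<bar> \<le> sum ?d {s..<k} * c"
    using A by (intro stochastic_matrix_abs_mult_le) (auto simp: stochastic_chain_def step.IH)
  moreover have "\<bar>((A k - B k) *v y k) $ i\<bar> \<le> ?d k * c"
    using abs_matrix_vector_mult_le[of "y k" c "A k - B k" i] bound[of k] step.hyps by simp
  ultimately have "\<bar>(y (Suc k) - x (Suc k)) $ i\<bar> \<le> sum ?d {s..<k} * c + ?d k * c"
    unfolding split by simp
  then show ?case
    using step.hyps by (simp add: algebra_simps)
qed

text \<open>Both \<open>s\<close> and \<open>x\<close> may depend on \<open>e\<close>; this suffices
  because the limit properties are tested for one tolerance at a time.\<close>

lemma l1_approximation_shadowing:
  fixes A B :: "nat \<Rightarrow> real^'m^'m"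
  assumes A: "stochastic_chain A" and B: "stochastic_chain B" and AB: "l1_approximation B A"
    and y: "dynamics_from B t y" and e: "0 < e"
  obtains s x where "dynamics_from A s x" "\<And>k i. s \<le> k \<Longrightarrow> \<bar>y k $ i - x k $ i\<bar> < e"
proof -
  let ?d = "\<lambda>r. \<Sum>i\<in>UNIV. \<Sum>j\<in>UNIV. \<bar>A r $ i $ j - B r $ i $ j\<bar>"
  \<comment> \<open>The summand 1 keeps \<open>c\<close> positive even if \<open>y t = 0\<close>, so
    that \<open>e / c\<close> is a legitimate tolerance.\<close>
  define c where "c = norm (y t) + 1"
  have c: "0 < c" by (simp add: c_def add_nonneg_pos)
  have "\<bar>y t $ j\<bar> \<le> c" for j
    using component_le_norm_cart[of "y t" j] by (simp add: c_def)
  then have bound: "\<bar>y k $ j\<bar> \<le> c" if "t \<le> k" for k j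
    using dynamics_from_abs_le[OF B y _ that] by blast
  have "summable ?d"
    using AB by (intro summable_sum) (simp add: l1_approximation_def)
  then obtain N where N: "\<And>m n. N \<le> m \<Longrightarrow> norm (sum ?d {m..<n}) < e / c"
    unfolding summable_Cauchy using divide_pos_pos[OF e c] by blast
  define s where "s = max N t"
  obtain x where x: "dynamics_from A s x" "x s = y s"
    using dynamics_from_exists by blast
  have "\<bar>y k $ i - x k $ i\<bar> < e" if "s \<le> k" for k i
  proof -
    have "\<bar>y k $ i - x k $ i\<bar> \<le> sum ?d {s..<k} * c"
      by (rule dynamics_from_diff_le[OF A x(1) dynamics_from_later[OF y] x(2)])
        (use bound that in \<open>auto simp: s_def\<close>)
    also have "\<dots> < e"
      using N[of s k] c by (simp add: s_def field_simps abs_less_iff)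
    finally show ?thesis .
  qed
  with x(1) show thesis using that by blast
qed

lemma mutually_weakly_ergodic_l1_approximation:
  assumes A: "stochastic_chain A" and B: "stochastic_chain B" and AB: "l1_approximation B A"
    and ij: "mutually_weakly_ergodic A i j"
  shows "mutually_weakly_ergodic B i j"
  unfolding mutually_weakly_ergodic_def
proof (intro allI impI)
  fix t y assume y: "dynamics_from B t y"
  show "(\<lambda>k. y k $ i - y k $ j) \<longlonglongrightarrow> 0"
  proof (rule LIMSEQ_I)
    fix e :: real assume "0 < e"
    \<comment> \<open>Two thirds pay for replacing \<open>y\<close> by \<open>x\<close> in the
      coordinates \<open>i\<close> and \<open>j\<close>, one for the limit along
      \<open>x\<close>.\<close>
    then have e: "0 < e / 3" by simp
    obtain s x where x: "dynamics_from A s x"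
      and close: "\<And>k i. s \<le> k \<Longrightarrow> \<bar>y k $ i - x k $ i\<bar> < e / 3"
      using l1_approximation_shadowing[OF A B AB y e] by blast
    have "(\<lambda>k. x k $ i - x k $ j) \<longlonglongrightarrow> 0"
      using ij x by (simp add: mutually_weakly_ergodic_def)
    then obtain N where N: "\<And>k. N \<le> k \<Longrightarrow> \<bar>x k $ i - x k $ j\<bar> < e / 3"
      using LIMSEQ_D[OF _ e] by fastforce
    have "norm (y k $ i - y k $ j - 0) < e" if "max s N \<le> k" for k
      using close[of k i] close[of k j] N[of k] that
      unfolding real_norm_def by arith
    then show "\<exists>N. \<forall>k\<ge>N. norm (y k $ i - y k $ j - 0) < e" by blast
  qed
qed

lemma ergodic_index_l1_approximation:
  assumes A: "stochastic_chain A" and B: "stochastic_chain B" and AB: "l1_approximation B A"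
    and i: "ergodic_index A i"
  shows "ergodic_index B i"
  unfolding ergodic_index_def
proof (intro allI impI)
  fix t y assume y: "dynamics_from B t y"
  \<comment> \<open>The Cauchy criterion avoids naming a limit: \<open>x\<close>, and with it the
    limit of its coordinate, changes with \<open>e\<close>.\<close>
  have "Cauchy (\<lambda>k. y k $ i)"
  proof (rule CauchyI)
    fix e :: real assume "0 < e"
    then have e: "0 < e / 3" by simp
    obtain s x where x: "dynamics_from A s x"
      and close: "\<And>k i. s \<le> k \<Longrightarrow> \<bar>y k $ i - x k $ i\<bar> < e / 3"
      using l1_approximation_shadowing[OF A B AB y e] by blast
    have "Cauchy (\<lambda>k. x k $ i)"
      using i x by (simp add: ergodic_index_def convergent_Cauchy)
    then obtain N where N: "\<And>m n. N \<le> m \<Longrightarrow> N \<le> n \<Longrightarrow> \<bar>x m $ i - x n $ i\<bar> < e / 3"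
      using CauchyD[OF _ e] by fastforce
    have "norm (y m $ i - y n $ i) < e" if "max s N \<le> m" "max s N \<le> n" for m n
      using close[of m i] close[of n i] N[of m n] that
      unfolding real_norm_def by arith
    then show "\<exists>M. \<forall>m\<ge>M. \<forall>n\<ge>M. norm (y m $ i - y n $ i) < e" by blast
  qed
  then show "convergent (\<lambda>k. y k $ i)"
    by (simp add: Cauchy_convergent_iff)
qed

text \<open>The two preceding lemmas pass only from \<open>A\<close> to \<open>B\<close>; symmetry
  yields the converse implications.\<close>

lemma l1_approximation_sym: "l1_approximation B A \<Longrightarrow> l1_approximation A B"
  by (simp add: l1_approximation_def abs_minus_commute)

theorem lemma1:
  fixes A B :: "nat \<Rightarrow> real^'m^'m"
  assumes "stochastic_chain A"
    and "stochastic_chain B"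
    and "l1_approximation B A"
  shows "same_ergodicity_classes A B"
  using assms l1_approximation_sym[OF assms(3)]
  unfolding same_ergodicity_classes_def same_ergodicity_classes_via_def
  by (auto intro: mutually_weakly_ergodic_l1_approximation ergodic_index_l1_approximation)

end
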